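(* Let $X$ be a $d$-dimensional real Banach space ($d \in \mathbb{N}$, $d\geq 1$) with norm $\|\cdot\|$ and a fixed basis $\mathbf{e}=\{e_1,\dots,e_d\}$, and let $F$ be a non-empty subset of $X$. If $\dim_{\mathrm{A}} F < d$, then $F$ does not contain arbitrarily large arithmetic patches (with respect to the basis $\mathbf{e}$).
   Context: Arithmetic patch: for $k \in \mathbb{N}$ ($k \ge 1$) and $\delta>0$, a set $P \subset X$ is an arithmetic patch of size $k$ and scale $\delta$ (with respect to $\mathbf{e}$) if $P = \{ t + \delta \sum_{i=1}^d x_i e_i : x_1,\dots,x_d \in \{0,1,\dots,k-1\} \}$ for some $t \in X$. A set $F \subseteq X$ contains arbitrarily large arithmetic patches (with respect to $\mathbf{e}$) if for all $k \in \mathbb{N}$ there exist $\delta>0$ and an arithmetic patch $P$ of size $k$ and scale $\delta$ (with respect to $\mathbf{e}$) such that $P \subseteq F$. Assouad dimension: $X$ carries the metric induced by $\|\cdot\|$. For a non-empty totally bounded set $E \subset X$ and $r>0$, $N_r(E)$ is the smallest number of open sets with diameter at most $r$ required to cover $E$. $B(x,R)$ is the closed ball centred at $x$ of radius $R$. For a non-empty set $F \subset X$, $\dim_{\mathrm{A}} F$ is the infimum of all $s \ge 0$ for which there exists $C>0$ such that for all $R>0$ and all $r \in (0,R)$ one has $\sup_{x \in F} N_r(B(x,R)\cap F) \le C (R/r)^s$. *)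

theory Defs
  imports "HOL-Analysis.Analysis"
begin

definition is_basis :: "nat \<Rightarrow> (nat \<Rightarrow> 'a::real_vector) \<Rightarrow> bool" where
  "is_basis d e \<longleftrightarrow> inj_on e {1..d} \<and> independent (e ` {1..d}) \<and> span (e ` {1..d}) = UNIV"

lemma is_basis_imp_dim_UNIV:
  assumes "is_basis d (e :: nat \<Rightarrow> 'a::real_vector)"
  shows "dim (UNIV :: 'a set) = d"
  using assms dim_span_eq_card_independent[of "e ` {1..d}"] card_image[of e "{1..d}"]
  unfolding is_basis_def by (metis card_atLeastAtMost add_diff_cancel_right' Suc_eq_plus1)

definition arithmetic_patch ::
  "nat \<Rightarrow> (nat \<Rightarrow> 'a::real_vector) \<Rightarrow> nat \<Rightarrow> real \<Rightarrow> 'a set \<Rightarrow> bool" where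
  "arithmetic_patch d e k \<delta> P \<longleftrightarrow> 1 \<le> k \<and> 0 < \<delta> \<and>
    (\<exists>t. P = {t + \<delta> *\<^sub>R (\<Sum>i=1..d. real (x i) *\<^sub>R e i) | x :: nat \<Rightarrow> nat.
                \<forall>i\<in>{1..d}. x i \<in> {0..k - 1}})"

definition contains_arbitrarily_large_patches ::
  "nat \<Rightarrow> (nat \<Rightarrow> 'a::real_vector) \<Rightarrow> 'a set \<Rightarrow> bool" where
  "contains_arbitrarily_large_patches d e F \<longleftrightarrow>
    (\<forall>k\<ge>1. \<exists>\<delta>>0. \<exists>P. arithmetic_patch d e k \<delta> P \<and> P \<subseteq> F)"

(* The library diameter is a real supremum, hence only meaningful on bounded sets;
   boundedness is therefore required explicitly. The value is infinite if there is no
   finite cover. *)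
definition covering_number :: "real \<Rightarrow> 'a::metric_space set \<Rightarrow> enat" where
  "covering_number r E =
    (INF \<U> \<in> {\<U>. finite \<U> \<and> (\<forall>U\<in>\<U>. open U \<and> bounded U \<and> diameter U \<le> r) \<and> E \<subseteq> \<Union>\<U>}.
      enat (card \<U>))"

(* Intended for non-empty F. The infimum of the empty set of exponents is infinity. *)
definition assouad_dim :: "'a::metric_space set \<Rightarrow> ereal" where
  "assouad_dim F = Inf {ereal s | s. 0 \<le> s \<and>
    (\<exists>C>0. \<forall>R>0. \<forall>r\<in>{0<..<R}.
      (SUP x\<in>F. ereal_of_enat (covering_number r (cball x R \<inter> F))) \<le> ereal (C * (R / r) powr s))}"

end

theory Submission
  imports Defs
begin

text \<open>
  The reason is a count of lattice points. In coordinates with respect to the basis, a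
  patch of size \<open>k\<close> and scale \<open>\<delta>\<close> consists of \<open>k ^ d\<close> points which lie in one ball of radius
  comparable to \<open>k * \<delta>\<close>, while any two of them are at distance at least comparable to \<open>\<delta>\<close>,
  because all norms on a finite-dimensional space are equivalent
  (\<open>coordinates_bounded_below\<close>). A set whose diameter is half that separation contains at
  most one point of the patch, so a set that contains the patch needs \<open>k ^ d\<close> covering sets
  at this scale (\<open>card_le_covering_number\<close>). The ratio of the two scales is a constant multiple
  of \<open>k\<close>, so an exponent \<open>s\<close> admissible for the Assouad dimension yields
  \<open>k ^ d \<le> K * k powr s\<close>, with \<open>K\<close> independent of \<open>k\<close> and \<open>\<delta>\<close>. If this holds for all \<open>k\<close>,
  then \<open>s \<ge> d\<close>.
\<close>

section \<open>Coordinates in a finite-dimensional normed space\<close>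

lemma independent_image_scalars_zero:
  fixes e :: "'i \<Rightarrow> 'b::real_vector"
  assumes "finite I" "inj_on e I" "independent (e ` I)"
    and "(\<Sum>i\<in>I. a i *\<^sub>R e i) = 0" "j \<in> I"
  shows "a j = 0"
proof -
  have "(\<Sum>v\<in>e ` I. a (inv_into I e v) *\<^sub>R v) = 0"
    using assms by (simp add: sum.reindex)
  then have "a (inv_into I e (e j)) = 0"
    using independentD[OF assms(3), of "e ` I" "\<lambda>v. a (inv_into I e v)" "e j"] assms by auto
  then show ?thesis
    using assms by simp
qed

text \<open>
  This is the equivalence of the given norm with the maximum norm of the coordinates. The norm
  is continuous in the coordinates and, by independence, vanishes only at the origin, so on each face
  \<open>{a. a j = 1 \<and> (\<forall>i. \<bar>a i\<bar> \<le> 1)}\<close> of the unit cube, compact by Tychonoff's theorem, it has a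
  positive minimum; every nonzero coordinate vector is a multiple of a vector in some face.
\<close>

lemma coordinates_bounded_below:
  fixes e :: "'i \<Rightarrow> 'b::real_normed_vector"
  assumes fin: "finite I" and inj: "inj_on e I" and indep: "independent (e ` I)"
  obtains c where "c > 0" "\<And>a i. i \<in> I \<Longrightarrow> c * \<bar>a i\<bar> \<le> norm (\<Sum>i\<in>I. a i *\<^sub>R e i)"
proof -
  define f where "f a = norm (\<Sum>i\<in>I. a i *\<^sub>R e i)" for a :: "'i \<Rightarrow> real"
  have cont: "continuous_on S f" for S
    unfolding f_def
    by (intro continuous_intros continuous_on_subset[OF continuous_on_product_coordinates]) auto
  have f_scale: "f (\<lambda>i. r * a i) = \<bar>r\<bar> * f a" for r a
    unfolding f_def by (simp flip: scaleR_scaleR scaleR_sum_right)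
  define B where "B j i = (if i = j then {1} else {-1..1::real})" for j i :: 'i
  have face: "\<exists>c>0. \<forall>a\<in>PiE UNIV (B j). c \<le> f a" if j: "j \<in> I" for j
  proof -
    have comp: "compact (PiE UNIV (B j))"
      using compactin_PiE[of "\<lambda>_. euclidean" UNIV "B j"]
      by (auto simp: euclidean_product_topology B_def)
    have "(\<lambda>_. 1) \<in> PiE UNIV (B j)"
      by (auto simp: B_def)
    then obtain a where a: "a \<in> PiE UNIV (B j)" "\<forall>b\<in>PiE UNIV (B j). f a \<le> f b"
      using continuous_attains_inf[OF comp _ cont] by blast
    have "a j \<in> B j j"
      using a(1) by blast
    then have "a j \<noteq> 0"
      by (simp add: B_def)
    then have "f a \<noteq> 0"
      using independent_image_scalars_zero[OF fin inj indep _ j] unfolding f_def by auto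
    then have "f a > 0"
      by (simp add: f_def)
    then show ?thesis
      using a(2) by blast
  qed
  then obtain c where c: "\<And>j. j \<in> I \<Longrightarrow> c j > 0"
      "\<And>j a. j \<in> I \<Longrightarrow> a \<in> PiE UNIV (B j) \<Longrightarrow> c j \<le> f a"
    by metis
  define m where "m = Min (insert 1 (c ` I))"
  have m: "m > 0" "\<And>j. j \<in> I \<Longrightarrow> m \<le> c j"
    using fin c(1) by (auto simp: m_def)
  have "m * \<bar>a i\<bar> \<le> f a" if i: "i \<in> I" for a i
  proof -
    obtain j where j: "j \<in> I" "\<And>i. i \<in> I \<Longrightarrow> \<bar>a i\<bar> \<le> \<bar>a j\<bar>"
      using obtains_MAX[OF fin, of "\<lambda>i. \<bar>a i\<bar>"] i fin
      by (metis Max_ge empty_iff finite_imageI image_eqI)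
    show ?thesis
    proof (cases "a j = 0")
      case True
      then show ?thesis
        using j(2)[OF i] by (simp add: f_def)
    next
      case False
      \<comment> \<open>The faces constrain the coordinates outside \<open>I\<close> as well, so these are set to \<open>0\<close>.\<close>
      define b where "b i = (if i \<in> I then inverse (a j) * a i else 0)" for i
      have "b \<in> PiE UNIV (B j)"
        using j False
        by (auto simp: B_def b_def abs_le_iff[symmetric] abs_mult divide_simps)
          (smt (verit) abs_divide divide_le_eq_1 j(2) abs_ge_self abs_ge_minus_self)+
      then have "c j \<le> f b"
        using c(2) j by blast
      also have "f b = f (\<lambda>i. inverse (a j) * a i)"
        unfolding f_def b_def by (intro arg_cong[where f = norm] sum.cong) auto
      also have "\<dots> = \<bar>inverse (a j)\<bar> * f a"
        by (rule f_scale)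
      finally have "c j * \<bar>a j\<bar> \<le> f a"
        using False by (simp add: field_simps)
      moreover have "m * \<bar>a i\<bar> \<le> c j * \<bar>a j\<bar>"
        using m j i by (intro mult_mono) (auto intro: less_imp_le c(1))
      ultimately show ?thesis
        by linarith
    qed
  qed
  then show thesis
    using that m(1) unfolding f_def by blast
qed

section \<open>Covering numbers of sets that contain separated points\<close>

lemma card_le_covering_number:
  fixes E :: "'b::metric_space set"
  assumes "finite A" "A \<subseteq> E"
    and sep: "\<And>x y. x \<in> A \<Longrightarrow> y \<in> A \<Longrightarrow> x \<noteq> y \<Longrightarrow> r < dist x y"
  shows "enat (card A) \<le> covering_number r E"
  unfolding covering_number_def
proof (rule INF_greatest)
  fix \<U> :: "'b set set"
  assume "\<U> \<in> {\<U>. finite \<U> \<and> (\<forall>U\<in>\<U>. open U \<and> bounded U \<and> diameter U \<le> r) \<and> E \<subseteq> \<Union>\<U>}"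
  then have \<U>: "finite \<U>" "\<And>U. U \<in> \<U> \<Longrightarrow> bounded U" "\<And>U. U \<in> \<U> \<Longrightarrow> diameter U \<le> r" "E \<subseteq> \<Union>\<U>"
    by auto
  have "\<exists>U\<in>\<U>. x \<in> U" if "x \<in> A" for x
    using that assms(2) \<U>(4) by blast
  then obtain g where g: "\<And>x. x \<in> A \<Longrightarrow> g x \<in> \<U>" "\<And>x. x \<in> A \<Longrightarrow> x \<in> g x"
    by metis
  have "inj_on g A"
  proof (rule inj_onI, rule ccontr)
    fix x y assume xy: "x \<in> A" "y \<in> A" "g x = g y" "x \<noteq> y"
    then have "dist x y \<le> diameter (g x)"
      using g \<U>(2) by (metis diameter_bounded_bound)
    also have "\<dots> \<le> r"
      using \<U>(3) g xy by blast
    finally show False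
      using sep[OF xy(1,2,4)] by simp
  qed
  then have "card A \<le> card \<U>"
    using g(1) \<U>(1) by (intro card_inj_on_le[of g]) auto
  then show "enat (card A) \<le> enat (card \<U>)"
    by simp
qed

section \<open>Patches and the Assouad dimension\<close>

text \<open>
  The finitely many coordinate vectors are represented by extensional functions, so that
  distinct representatives give distinct points of the patch and the points can be counted.
\<close>

lemma patch_covering_number:
  fixes e :: "nat \<Rightarrow> 'b::real_normed_vector"
  assumes c: "c > 0" "\<And>a i. i \<in> {1..d} \<Longrightarrow> c * \<bar>a i\<bar> \<le> norm (\<Sum>i=1..d. a i *\<^sub>R e i)"
    and patch: "arithmetic_patch d e k \<delta> P" "P \<subseteq> F"
  obtains t where "t \<in> F"
    "enat (k ^ d) \<le> covering_number (c * \<delta> / 2) (cball t (\<delta> * (real k * (\<Sum>i=1..d. norm (e i)))) \<inter> F)"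
proof -
  from patch(1) obtain t where k: "1 \<le> k" and \<delta>: "0 < \<delta>"
    and P: "P = {t + \<delta> *\<^sub>R (\<Sum>i=1..d. real (x i) *\<^sub>R e i) | x :: nat \<Rightarrow> nat.
                \<forall>i\<in>{1..d}. x i \<in> {0..k - 1}}"
    unfolding arithmetic_patch_def by blast
  define p where "p x = t + \<delta> *\<^sub>R (\<Sum>i=1..d. real (x i) *\<^sub>R e i)" for x :: "nat \<Rightarrow> nat"
  define X where "X = PiE {1..d} (\<lambda>_. {0..k - 1})"
  have P_eq: "p x \<in> P" if "\<forall>i\<in>{1..d}. x i \<in> {0..k - 1}" for x
    using that unfolding P p_def by blast
  have "p (\<lambda>_. 0) \<in> P"
    by (rule P_eq) simp
  then have "t \<in> F"
    using patch(2) by (auto simp: p_def)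
  have sep: "c * \<delta> / 2 < dist (p x) (p y)" if xy: "x \<in> X" "y \<in> X" "x \<noteq> y" for x y
  proof -
    obtain i where i: "i \<in> {1..d}" "x i \<noteq> y i"
      using xy unfolding X_def by (meson PiE_ext)
    have "p x - p y = \<delta> *\<^sub>R (\<Sum>i=1..d. (real (x i) - real (y i)) *\<^sub>R e i)"
      by (simp add: p_def scaleR_diff_left sum_subtractf flip: scaleR_diff_right)
    then have eq: "dist (p x) (p y) = \<delta> * norm (\<Sum>i=1..d. (real (x i) - real (y i)) *\<^sub>R e i)"
      using \<delta> by (simp add: dist_norm)
    have "c * 1 \<le> c * \<bar>real (x i) - real (y i)\<bar>"
      using i(2) c(1) by (intro mult_left_mono) linarith+
    also have "\<dots> \<le> norm (\<Sum>i=1..d. (real (x i) - real (y i)) *\<^sub>R e i)"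
      by (rule c(2)[OF i(1), where a = "\<lambda>i. real (x i) - real (y i)"])
    finally have "\<delta> * c \<le> dist (p x) (p y)"
      using \<delta> by (simp add: eq)
    moreover have "c * \<delta> / 2 < \<delta> * c"
      using c(1) \<delta> by simp
    ultimately show ?thesis
      by linarith
  qed
  have inj: "inj_on p X"
    using sep c(1) \<delta> by (intro inj_onI) (smt (verit) dist_self divide_pos_pos mult_pos_pos)
  have "finite X"
    unfolding X_def by (intro finite_PiE) auto
  have "card (p ` X) = k ^ d"
    using k by (simp add: card_image[OF inj]) (simp add: X_def card_PiE)
  moreover have "p ` X \<subseteq> cball t (\<delta> * (real k * (\<Sum>i=1..d. norm (e i)))) \<inter> F"
  proof (rule image_subsetI, rule IntI)
    fix x assume x: "x \<in> X"
    then have "\<forall>i\<in>{1..d}. x i \<in> {0..k - 1}"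
      unfolding X_def by blast
    then show "p x \<in> F"
      using P_eq patch(2) by blast
    have "norm (\<Sum>i=1..d. real (x i) *\<^sub>R e i) \<le> (\<Sum>i=1..d. real k * norm (e i))"
    proof (rule sum_norm_le)
      fix i assume "i \<in> {1..d}"
      then have "x i \<le> k"
        using PiE_mem[OF x[unfolded X_def]] by fastforce
      then show "norm (real (x i) *\<^sub>R e i) \<le> real k * norm (e i)"
        by (simp add: mult_right_mono)
    qed
    then show "p x \<in> cball t (\<delta> * (real k * (\<Sum>i=1..d. norm (e i))))"
      using \<delta> by (simp add: p_def dist_norm flip: sum_distrib_left)
  qed
  ultimately have "enat (k ^ d) \<le> covering_number (c * \<delta> / 2)
      (cball t (\<delta> * (real k * (\<Sum>i=1..d. norm (e i)))) \<inter> F)"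
    using card_le_covering_number[of "p ` X"] \<open>finite X\<close> sep by (smt (verit) finite_imageI imageE)
  then show thesis
    using that \<open>t \<in> F\<close> by blast
qed

lemma power_not_bounded_by_smaller_powr:
  assumes "s < real d"
  shows "\<exists>k\<ge>1. K * real k powr s < real (k ^ d)"
proof -
  define u where "u = real d - s"
  have "u > 0"
    using assms by (simp add: u_def)
  \<comment> \<open>The power \<open>k powr (d - s)\<close> must exceed \<open>K\<close>, which determines how large \<open>k\<close> has to be.\<close>
  define k where "k = nat \<lceil>(\<bar>K\<bar> + 1) powr (1 / u)\<rceil>"
  have lb: "(\<bar>K\<bar> + 1) powr (1 / u) \<le> real k"
    unfolding k_def by (rule real_nat_ceiling_ge)
  have "0 < (\<bar>K\<bar> + 1) powr (1 / u)"
    by simp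
  with lb have "0 < real k"
    by linarith
  have "K < ((\<bar>K\<bar> + 1) powr (1 / u)) powr u"
    using \<open>u > 0\<close> by (simp add: powr_powr)
  also have "\<dots> \<le> real k powr u"
    using lb \<open>u > 0\<close> by (intro powr_mono2) auto
  finally have "K * real k powr s < real k powr u * real k powr s"
    using \<open>0 < real k\<close> by simp
  also have "\<dots> = real (k ^ d)"
    using \<open>0 < real k\<close> by (simp add: u_def powr_realpow flip: powr_add)
  finally show ?thesis
    using \<open>0 < real k\<close> by (intro exI[of _ k]) auto
qed

theorem theorem2p1:
  fixes d :: nat and e :: "nat \<Rightarrow> 'a::banach" and F :: "'a set"
  assumes "1 \<le> d"
    and "is_basis d e"
    and "F \<noteq> {}"
    and "assouad_dim F < ereal (real d)"
  shows "\<not> contains_arbitrarily_large_patches d e F"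
proof
  assume patches: "contains_arbitrarily_large_patches d e F"
  obtain s C where s: "s < real d" and "C > 0"
    and cov: "\<And>R r. R > 0 \<Longrightarrow> r \<in> {0<..<R} \<Longrightarrow>
      (SUP x\<in>F. ereal_of_enat (covering_number r (cball x R \<inter> F))) \<le> ereal (C * (R / r) powr s)"
    using assms(4) unfolding assouad_dim_def Inf_less_iff by force
  obtain c where c: "c > 0"
      "\<And>a i. i \<in> {1..d} \<Longrightarrow> c * \<bar>a i\<bar> \<le> norm (\<Sum>i=1..d. a i *\<^sub>R e i)"
    using coordinates_bounded_below[of "{1..d}" e] assms(2) unfolding is_basis_def by blast
  define S where "S = (\<Sum>i=1..d. norm (e i))"
  have "c \<le> norm (\<Sum>i=1..d. 1 *\<^sub>R e i)"
    using c(2)[of 1 "\<lambda>_. 1"] assms(1) by simp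
  also have "\<dots> \<le> S"
    unfolding S_def by (simp add: norm_sum)
  finally have "c \<le> S" .
  obtain k where k: "k \<ge> 1" "C * (2 * S / c) powr s * real k powr s < real (k ^ d)"
    using power_not_bounded_by_smaller_powr[OF s] by blast
  obtain \<delta> P where P: "\<delta> > 0" "arithmetic_patch d e k \<delta> P" "P \<subseteq> F"
    using patches k(1) unfolding contains_arbitrarily_large_patches_def by blast
  define R where "R = \<delta> * (real k * S)"
  define r where "r = c * \<delta> / 2"
  obtain t where t: "t \<in> F" "enat (k ^ d) \<le> covering_number r (cball t R \<inter> F)"
    using patch_covering_number[OF c P(2,3)] unfolding R_def r_def S_def by blast
  have "r > 0"
    using c P by (simp add: r_def)
  have "r < \<delta> * c"
    using c P by (simp add: r_def)
  also have "\<delta> * c \<le> R"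
    unfolding R_def using \<open>c \<le> S\<close> c k P mult_mono[of 1 "real k" c S]
    by (intro mult_left_mono) auto
  finally have "r < R" .
  have "ereal (real (k ^ d)) = ereal_of_enat (enat (k ^ d))"
    by simp
  also have "\<dots> \<le> ereal_of_enat (covering_number r (cball t R \<inter> F))"
    using t(2) by (simp only: ereal_of_enat_le_iff)
  also have "\<dots> \<le> (SUP x\<in>F. ereal_of_enat (covering_number r (cball x R \<inter> F)))"
    using t(1) by (rule SUP_upper)
  also have "\<dots> \<le> ereal (C * (R / r) powr s)"
    using cov \<open>r > 0\<close> \<open>r < R\<close> by simp
  finally have "real (k ^ d) \<le> C * (R / r) powr s"
    by simp
  also have "R / r = (2 * S / c) * real k"
    using c P by (simp add: R_def r_def field_simps)
  also have "\<dots> powr s = (2 * S / c) powr s * real k powr s"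
    by (rule powr_mult)
  finally show False
    using k(2) by (simp add: mult.assoc)
qed

end
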